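(* Let $\tau\in\mathbb{C}$ with $\mathrm{Im}(\tau)>0$, $q=e^{2\pi i\tau}$, $\alpha\in\mathbb{C}$, $a=q^{\alpha}=e^{2\pi i\alpha\tau}$, and let $\widetilde f_0(x)={}_2\phi_0\left(\begin{matrix} a,0 \\ - \end{matrix};q,\frac{x}{a}\right)$ be the formal power series solution at $x=0$, and $f_0(x,\lambda)=x^{\alpha/2}\,\mathcal{L}^{+}\circ\mathcal{B}^{+}(\widetilde f_0)(x,\lambda)$ its image under the $q$-Borel and $q$-Laplace transformations (multiplied by $x^{\alpha/2}$). Then for all $u,v\in\mathbb{C}$ with $u-\alpha\tau,\,v\notin\mathbb{Z}+\mathbb{Z}\tau$, $$f_0\big(e^{2\pi i(u-v)},-e^{2\pi iu}\big)=i\,q^{1/8}\,\mu(u,v;\alpha),$$ where $x^{\alpha/2}$ at $x=e^{2\pi i(u-v)}$ is understood as $e^{\pi i\alpha(u-v)}$.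
   Context: Powers: $q^{s}:=e^{2\pi i s\tau}$. $(x)_\infty=(x;q)_\infty=\prod_{j\ge0}(1-xq^j)$, $(x)_n=(x)_\infty/(q^nx)_\infty$ for $n\in\mathbb{Z}$, $(x_1,\dots,x_m)_\infty=(x_1)_\infty\cdots(x_m)_\infty$. $\theta_q(x)=(q,-x,-q/x)_\infty=\sum_{n\in\mathbb{Z}}x^nq^{n(n-1)/2}$. $\vartheta_{11}(u)=\sum_{n\in\mathbb{Z}}e^{2\pi i(n+\frac12)(u+\frac12)+\pi i(n+\frac12)^2\tau}$. Basic hypergeometric series (as formal or convergent series): ${}_r\phi_s\left(\begin{matrix} a_1,\dots,a_r \\ b_1,\dots,b_s \end{matrix};q,x\right)=\sum_{n\ge0}\frac{(a_1)_n\cdots(a_r)_n}{(b_1)_n\cdots(b_s)_n(q)_n}\big((-1)^nq^{n(n-1)/2}\big)^{s-r+1}x^n$. Thus $\widetilde f_0(x)=\sum_{n\ge0}\frac{(a)_n}{(q)_n}(-1)^nq^{-n(n-1)/2}(x/a)^n$. It corresponds (after multiplication by $x^{\alpha/2}$) to a formal solution of the $q$-Hermite--Weber equation $[T_x^2-(1-xq)\sqrt a\,T_x-xq]f(x)=0$, where $T_xf(x)=f(qx)$, $\sqrt a=q^{\alpha/2}$. $q$-Borel transformation of $f=\sum_{n\ge0}a_nx^n$: $\mathcal{B}^{+}(f)(\xi)=\sum_{n\ge0}a_nq^{n(n-1)/2}\xi^n$ (continued meromorphically to $\mathbb{C}$). $q$-Laplace transformation: $\mathcal{L}^{+}(f)(x,\lambda)=\sum_{n\in\mathbb{Z}}\frac{f(\lambda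 q^n)}{\theta_q(\lambda q^n/x)}$. Generalized $\mu$-function: for $u-\alpha\tau,v\notin\mathbb{Z}+\mathbb{Z}\tau$, $$\mu(u,v;\alpha)=\frac{e^{\pi i\alpha(u-v)}}{\vartheta_{11}(v)}\sum_{n\in\mathbb{Z}}(-1)^ne^{2\pi i(n+\frac12)v}q^{\frac{n(n+1)}2}\frac{(e^{2\pi iu}q^{n+1})_\infty}{(e^{2\pi iu}q^{n-\alpha+1})_\infty}.$$ *)

theory Defs
  imports "HOL-Complex_Analysis.Complex_Analysis"
begin

definition qpow :: "complex \<Rightarrow> complex \<Rightarrow> complex" where
  "qpow \<tau> s = exp (2 * of_real pi * \<i> * s * \<tau>)"

definition qpoch_inf :: "complex \<Rightarrow> complex \<Rightarrow> complex" where
  "qpoch_inf q x = (\<Prod>j. 1 - x * q ^ j)"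

(* The quotient (x)_inf / (q^n x)_inf for n \<ge> 0, in its cancelled form: the quotient
   itself is 0 / 0 when x is a power q^(-k) with k \<ge> n, whereas (x)_n is still meant
   to be the finite product.  See lemma qpoch_eq_quotient. *)
definition qpoch :: "complex \<Rightarrow> complex \<Rightarrow> nat \<Rightarrow> complex" where
  "qpoch q x n = (\<Prod>j<n. 1 - x * q ^ j)"

lemma qpoch_inf_split:
  assumes "norm q < 1"
  shows "qpoch_inf q x = qpoch q x n * qpoch_inf q (q ^ n * x)"
proof -
  have "summable (\<lambda>i. norm ((1 - x * q ^ i) - 1))"
    using assms by (simp add: norm_mult norm_power summable_geometric summable_mult)
  then have "convergent_prod (\<lambda>i. 1 - x * q ^ i)"
    by (intro abs_convergent_prod_imp_convergent_prod summable_imp_abs_convergent_prod)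
  from convergent_prod_has_prod[OF this]
  have *: "(\<lambda>i. 1 - x * q ^ i) has_prod qpoch_inf q x"
    by (simp add: qpoch_inf_def)
  have "summable (\<lambda>i. norm ((1 - q ^ n * x * q ^ i) - 1))"
    using assms by (simp add: norm_mult norm_power summable_geometric summable_mult)
  then have "convergent_prod (\<lambda>i. 1 - q ^ n * x * q ^ i)"
    by (intro abs_convergent_prod_imp_convergent_prod summable_imp_abs_convergent_prod)
  from convergent_prod_has_prod[OF this]
  have **: "(\<lambda>i. 1 - q ^ n * x * q ^ i) has_prod qpoch_inf q (q ^ n * x)"
    by (simp add: qpoch_inf_def)
  have "(\<lambda>i. \<Prod>j\<le>i. 1 - x * q ^ j) \<longlonglongrightarrow> qpoch_inf q x"
    by (rule has_prod_imp_tendsto[OF *])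
  then have 1: "(\<lambda>i. \<Prod>j<i. 1 - x * q ^ j) \<longlonglongrightarrow> qpoch_inf q x"
    by (subst filterlim_sequentially_Suc[symmetric]) (simp add: lessThan_Suc_atMost)
  have "(\<lambda>i. \<Prod>j\<le>i. 1 - q ^ n * x * q ^ j) \<longlonglongrightarrow> qpoch_inf q (q ^ n * x)"
    by (rule has_prod_imp_tendsto[OF **])
  then have 2: "(\<lambda>i. \<Prod>j<i. 1 - q ^ n * x * q ^ j) \<longlonglongrightarrow> qpoch_inf q (q ^ n * x)"
    by (subst filterlim_sequentially_Suc[symmetric]) (simp add: lessThan_Suc_atMost)
  have "(\<Prod>j<i + n. 1 - x * q ^ j) = qpoch q x n * (\<Prod>j<i. 1 - q ^ n * x * q ^ j)" for i
    by (induction i) (simp_all add: qpoch_def power_add algebra_simps)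
  with tendsto_mult[OF tendsto_const[of "qpoch q x n"] 2]
  have "(\<lambda>i. \<Prod>j<i + n. 1 - x * q ^ j) \<longlonglongrightarrow> qpoch q x n * qpoch_inf q (q ^ n * x)"
    by simp
  then show ?thesis
    using LIMSEQ_unique LIMSEQ_ignore_initial_segment[OF 1, of n] by blast
qed

lemma qpoch_eq_quotient:
  assumes "norm q < 1" "qpoch_inf q (q ^ n * x) \<noteq> 0"
  shows "qpoch q x n = qpoch_inf q x / qpoch_inf q (q ^ n * x)"
  using qpoch_inf_split[OF assms(1), of x n] assms(2) by simp

definition theta_q :: "complex \<Rightarrow> complex \<Rightarrow> complex" where
  "theta_q q x = qpoch_inf q q * qpoch_inf q (- x) * qpoch_inf q (- q / x)"

definition vartheta11 :: "complex \<Rightarrow> complex \<Rightarrow> complex" where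
  "vartheta11 \<tau> u = (\<Sum>\<^sub>\<infinity>n::int.
     exp (2 * of_real pi * \<i> * (of_int n + 1 / 2) * (u + 1 / 2)
          + of_real pi * \<i> * (of_int n + 1 / 2)\<^sup>2 * \<tau>))"

definition basic_hypergeometric_fps ::
    "complex \<Rightarrow> complex list \<Rightarrow> complex list \<Rightarrow> complex fps" where
  "basic_hypergeometric_fps q as bs = Abs_fps (\<lambda>n.
     (\<Prod>a\<leftarrow>as. qpoch q a n) / ((\<Prod>b\<leftarrow>bs. qpoch q b n) * qpoch q q n)
     * ((-1) ^ n * q ^ (n * (n - 1) div 2)) powi (int (length bs) - int (length as) + 1))"

definition qBorel_fps :: "complex \<Rightarrow> complex fps \<Rightarrow> complex fps" where
  "qBorel_fps q F = Abs_fps (\<lambda>n. fps_nth F n * q ^ (n * (n - 1) div 2))"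

(* The meromorphic function on the whole plane with Taylor series F at 0.
   The adverb nicely makes it unique as a function: removable singularities are
   filled in, and the value at a pole is 0 by convention. *)
definition meromorphic_continuation :: "complex fps \<Rightarrow> complex \<Rightarrow> complex" where
  "meromorphic_continuation F = (THE g. g nicely_meromorphic_on UNIV \<and> g has_fps_expansion F)"

definition qBorel :: "complex \<Rightarrow> complex fps \<Rightarrow> complex \<Rightarrow> complex" where
  "qBorel q F = meromorphic_continuation (qBorel_fps q F)"

definition qLaplace :: "complex \<Rightarrow> (complex \<Rightarrow> complex) \<Rightarrow> complex \<Rightarrow> complex \<Rightarrow> complex" where
  "qLaplace q f x l = (\<Sum>\<^sub>\<infinity>n::int. f (l * q powi n) / theta_q q (l * q powi n / x))"

definition f0_formal :: "complex \<Rightarrow> complex \<Rightarrow> complex fps" where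
  "f0_formal \<tau> \<alpha> = (let q = qpow \<tau> 1; a = qpow \<tau> \<alpha> in
     basic_hypergeometric_fps q [a, 0] [] oo (fps_const (1 / a) * fps_X))"

(* x ^ (\<alpha> / 2) is multivalued in x, so the argument is w with x = exp (2 \<pi> i w),
   and the branch is exp (\<pi> i \<alpha> w). *)
definition f0 :: "complex \<Rightarrow> complex \<Rightarrow> complex \<Rightarrow> complex \<Rightarrow> complex" where
  "f0 \<tau> \<alpha> w l = exp (of_real pi * \<i> * \<alpha> * w)
     * qLaplace (qpow \<tau> 1) (qBorel (qpow \<tau> 1) (f0_formal \<tau> \<alpha>)) (exp (2 * of_real pi * \<i> * w)) l"

definition gen_mu :: "complex \<Rightarrow> complex \<Rightarrow> complex \<Rightarrow> complex \<Rightarrow> complex" where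
  "gen_mu \<tau> u v \<alpha> = exp (of_real pi * \<i> * \<alpha> * (u - v)) / vartheta11 \<tau> v
     * (\<Sum>\<^sub>\<infinity>n::int. (-1) powi n * exp (2 * of_real pi * \<i> * (of_int n + 1 / 2) * v)
          * qpow \<tau> (of_int n * (of_int n + 1) / 2)
          * qpoch_inf (qpow \<tau> 1) (exp (2 * of_real pi * \<i> * u) * qpow \<tau> (of_int n + 1))
          / qpoch_inf (qpow \<tau> 1) (exp (2 * of_real pi * \<i> * u) * qpow \<tau> (of_int n - \<alpha> + 1)))"

definition period_lattice :: "complex \<Rightarrow> complex set" where
  "period_lattice \<tau> = {of_int m + of_int n * \<tau> | m n. True}"

end

theory Submission
  imports Defs
begin

text \<open>
  The \<open>q\<close>-Borel transform turns the divergent series into an infinite product. Its \<open>n\<close>-th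
  coefficient becomes \<open>(a)\<^sub>n / (q)\<^sub>n (- 1 / a)\<^sup>n\<close>, so the \<open>q\<close>-binomial theorem sums it to
  \<open>(- \<xi>)\<^sub>\<infinity> / (- \<xi> / a)\<^sub>\<infinity>\<close>, a quotient of entire functions. The points \<open>\<xi> = - U q\<^sup>n\<close> with
  \<open>U = exp (2 \<pi> \<i> u)\<close>, at which the \<open>q\<close>-Laplace transform samples it, are not poles
  because \<open>u - \<alpha> \<tau>\<close> avoids the period lattice (\<open>qBorel_f0_formal\<close>,
  \<open>exp_times_qpow_int_neq_1\<close>).

  With \<open>x = exp (2 \<pi> \<i> (u - v))\<close> and \<open>y = exp (2 \<pi> \<i> v)\<close>, the denominators of the \<open>q\<close>-Laplace
  transform are \<open>\<theta>\<^sub>q (- y q\<^sup>n)\<close>. Quasi-periodicity of \<open>\<theta>\<^sub>q\<close> makes them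
  \<open>\<theta>\<^sub>q (- y)\<close> divided by \<open>(- y)\<^sup>n q\<^bsup>n (n - 1) / 2\<^esup>\<close> (\<open>theta_q_shift\<close>). What remains is, up to
  the shift \<open>n \<mapsto> n + 1\<close> of the summation index, the series of the generalized
  \<open>\<mu>\<close>-function, and the prefactors agree because \<open>\<vartheta>\<^sub>1\<^sub>1 (v)\<close> is an explicit exponential
  times \<open>\<theta>\<^sub>q (- y)\<close> (\<open>vartheta11_eq_theta_q\<close>).

  Both facts on theta functions compare a product with a bilateral series, that is, they rest on
  the Jacobi triple product. It is obtained as the limit of its finite form, which is the finite
  \<open>q\<close>-binomial theorem with the index centred at \<open>N\<close>; Tannery's theorem justifies the limit.
\<close>

section \<open>The infinite q-shifted factorial\<close>

lemma convergent_prod_qpoch_inf: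
  fixes q :: complex
  assumes "norm q < 1"
  shows "convergent_prod (\<lambda>j. 1 - x * q ^ j)"
proof -
  have "summable (\<lambda>j. norm ((1 - x * q ^ j) - 1))"
    using assms by (simp add: norm_mult norm_power summable_geometric summable_mult)
  then show ?thesis
    by (intro abs_convergent_prod_imp_convergent_prod summable_imp_abs_convergent_prod)
qed

lemma qpoch_tendsto_qpoch_inf:
  assumes "norm q < 1"
  shows "qpoch q x \<longlonglongrightarrow> qpoch_inf q x"
proof -
  have "(\<lambda>n. \<Prod>j\<le>n. 1 - x * q ^ j) \<longlonglongrightarrow> qpoch_inf q x"
    unfolding qpoch_inf_def
    by (intro convergent_prod_LIMSEQ convergent_prod_qpoch_inf assms)
  then have "(\<lambda>n. qpoch q x (Suc n)) \<longlonglongrightarrow> qpoch_inf q x"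
    by (simp add: qpoch_def lessThan_Suc_atMost)
  then show ?thesis
    by (simp only: filterlim_sequentially_Suc)
qed

lemma qpoch_inf_nonzero:
  assumes "norm q < 1" "\<And>j. x * q ^ j \<noteq> 1"
  shows "qpoch_inf q x \<noteq> 0"
  unfolding qpoch_inf_def
  using assms(2) by (intro prodinf_nonzero convergent_prod_qpoch_inf assms(1)) (metis eq_iff_diff_eq_0)

lemma qpoch_inf_rec:
  assumes "norm q < 1"
  shows "qpoch_inf q x = (1 - x) * qpoch_inf q (q * x)"
  using qpoch_inf_split[OF assms, of x 1] by (simp add: qpoch_def)

lemma power_neq_1_of_norm_less_1:
  fixes q :: complex
  assumes "norm q < 1"
  shows "q ^ Suc n \<noteq> 1"
proof
  assume "q ^ Suc n = 1"
  then have "norm q ^ Suc n = 1"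
    by (metis norm_one norm_power)
  moreover have "norm q ^ Suc n < 1"
    using assms by (cases "q = 0") (auto intro!: power_Suc_less_one simp del: power_Suc simp: power_0_left)
  ultimately show False by simp
qed

lemma qpoch_q_nonzero:
  assumes "norm q < 1"
  shows "qpoch q q n \<noteq> 0"
proof -
  have "1 - q * q ^ j \<noteq> 0" for j
    using power_neq_1_of_norm_less_1[OF assms, of j] by simp
  then show ?thesis by (simp add: qpoch_def)
qed

lemma qpoch_inf_q_nonzero:
  assumes "norm q < 1"
  shows "qpoch_inf q q \<noteq> 0"
  using power_neq_1_of_norm_less_1[OF assms] by (intro qpoch_inf_nonzero assms) (metis power_Suc)

lemma qpoch_inf_0 [simp]: "qpoch_inf q 0 = 1"
  by (simp add: qpoch_inf_def)

text \<open>
  On a disc the factors differ from \<open>1\<close> by at most a geometric sequence, so the partial products,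
  which are polynomials, converge uniformly.
\<close>

lemma qpoch_inf_holomorphic:
  assumes "norm q < 1"
  shows "qpoch_inf q holomorphic_on UNIV"
proof (rule holomorphic_uniform_sequence)
  fix z :: complex
  let ?K = "cball z 1"
  define R where "R = norm z + 1"
  have R: "norm x \<le> R" if "x \<in> ?K" for x
    using norm_triangle_ineq2[of x z] that by (auto simp: dist_norm norm_minus_commute R_def)
  have "uniformly_convergent_on ?K (\<lambda>N x. \<Prod>j<N. 1 - x * q ^ j)"
  proof (rule uniformly_convergent_on_prod')
    show "uniformly_convergent_on ?K (\<lambda>N x. \<Sum>j<N. norm (1 - x * q ^ j - 1))"
    proof (rule Weierstrass_m_test')
      show "norm (norm (1 - x * q ^ j - 1)) \<le> R * norm q ^ j" if "x \<in> ?K" for j x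
        using R[OF that] by (simp add: norm_mult norm_power mult_right_mono)
      show "summable (\<lambda>j. R * norm q ^ j)"
        using assms by (intro summable_mult summable_geometric) simp
    qed
  qed (auto intro!: continuous_intros)
  then obtain g where g: "uniform_limit ?K (\<lambda>N x. qpoch q x N) g sequentially"
    by (auto simp: uniformly_convergent_on_def qpoch_def)
  moreover have "g x = qpoch_inf q x" if "x \<in> ?K" for x
    using tendsto_uniform_limitI[OF g that] qpoch_tendsto_qpoch_inf[OF assms] LIMSEQ_unique by blast
  ultimately have "uniform_limit ?K (\<lambda>N x. qpoch q x N) (qpoch_inf q) sequentially"
    by (metis (mono_tags, lifting) uniform_limit_cong')
  then show "\<exists>d>0. cball z d \<subseteq> UNIV \<and> uniform_limit (cball z d) (\<lambda>N x. qpoch q x N) (qpoch_inf q) sequentially"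
    by (intro exI[of _ 1]) auto
qed (auto simp: qpoch_def intro!: holomorphic_intros)

lemma qpoch_inf_analytic:
  assumes "norm q < 1" "f analytic_on A"
  shows "(\<lambda>z. qpoch_inf q (f z)) analytic_on A"
proof -
  have "qpoch_inf q analytic_on UNIV"
    using qpoch_inf_holomorphic[OF assms(1)] by (simp add: analytic_on_open)
  then have "(qpoch_inf q \<circ> f) analytic_on A"
    by (intro analytic_on_compose_gen[OF assms(2)]) auto
  then show ?thesis by (simp add: o_def)
qed

section \<open>The q-binomial theorem and the q-Borel transform\<close>

text \<open>
  The quotient \<open>g\<close> satisfies \<open>(1 - z) g (z) = (1 - a z) g (q z)\<close>, since passing from \<open>z\<close> to \<open>q z\<close>
  removes the first factor of each product. Comparing coefficients gives
  \<open>(1 - q\<^bsup>n + 1\<^esup>) g\<^sub>n\<^sub>+\<^sub>1 = (1 - a q\<^sup>n) g\<^sub>n\<close>, and this recursion determines the Taylor series because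
  no power of \<open>q\<close> with positive exponent equals \<open>1\<close>.
\<close>

lemma q_binomial_theorem:
  assumes q: "norm q < 1"
  shows "(\<lambda>z. qpoch_inf q (a * z) / qpoch_inf q z) has_fps_expansion
           Abs_fps (\<lambda>n. qpoch q a n / qpoch q q n)"
proof -
  define g where "g = (\<lambda>z. qpoch_inf q (a * z) / qpoch_inf q z)"
  define G where "G = fps_expansion g 0"
  have "g analytic_on {0}"
    unfolding g_def by (intro analytic_on_divide qpoch_inf_analytic q analytic_intros) auto
  then have G: "g has_fps_expansion G"
    unfolding G_def by (rule analytic_at_imp_has_fps_expansion_0)
  have "(g \<circ> (\<lambda>z. q * z)) has_fps_expansion (G oo (fps_const q * fps_X))"
    by (rule has_fps_expansion_compose[OF G]) (auto intro!: fps_expansion_intros)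
  then have R: "(\<lambda>z. (1 - a * z) * (g \<circ> (\<lambda>z. q * z)) z) has_fps_expansion
      (1 - fps_const a * fps_X) * (G oo (fps_const q * fps_X))"
    by (rule has_fps_expansion_mult[rotated]) (intro fps_expansion_intros)
  have L: "(\<lambda>z. (1 - z) * g z) has_fps_expansion (1 - fps_X) * G"
    by (intro fps_expansion_intros G)
  have "(1 - z) * g z = (1 - a * z) * (g \<circ> (\<lambda>z. q * z)) z" if "z \<noteq> 1" for z
    using that qpoch_inf_rec[OF q, of z] qpoch_inf_rec[OF q, of "a * z"]
    by (simp add: g_def mult_ac)
  then have "eventually (\<lambda>z. (1 - z) * g z = (1 - a * z) * (g \<circ> (\<lambda>z. q * z)) z) (nhds 0)"
    using t1_space_nhds[of "0::complex" 1] by (auto elim: eventually_mono)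
  with L have "(\<lambda>z. (1 - a * z) * (g \<circ> (\<lambda>z. q * z)) z) has_fps_expansion (1 - fps_X) * G"
    by (subst (asm) has_fps_expansion_cong) auto
  with R have eq: "(1 - fps_X) * G = (1 - fps_const a * fps_X) * (G oo (fps_const q * fps_X))"
    by (metis fps_expansion_unique_complex)
  have G0: "fps_nth G 0 = 1"
    using has_fps_expansion_imp_0_eq_fps_nth_0[OF G] by (simp add: g_def)
  have "fps_nth G n = qpoch q a n / qpoch q q n" for n
  proof (induction n)
    case 0
    then show ?case by (simp add: G0 qpoch_def)
  next
    case (Suc n)
    have "fps_nth ((1 - fps_X) * G) (Suc n)
        = fps_nth ((1 - fps_const a * fps_X) * (G oo (fps_const q * fps_X))) (Suc n)"
      by (simp only: eq)
    then have "fps_nth G (Suc n) - fps_nth G n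
        = q ^ Suc n * fps_nth G (Suc n) - a * (q ^ n * fps_nth G n)"
      by (simp add: left_diff_distrib mult.assoc)
    then have "(1 - q ^ Suc n) * fps_nth G (Suc n) = (1 - a * q ^ n) * fps_nth G n"
      by (simp add: algebra_simps)
    then show ?case
      using Suc power_neq_1_of_norm_less_1[OF q, of n] qpoch_q_nonzero[OF q, of n]
      by (simp add: qpoch_def field_simps)
  qed
  then have "G = Abs_fps (\<lambda>n. qpoch q a n / qpoch q q n)"
    by (simp add: fps_eq_iff)
  with G show ?thesis by (simp add: g_def)
qed

text \<open>
  The difference vanishes near \<open>0\<close>, hence identically up to removable singularities. So the two
  functions agree on a punctured neighbourhood of every point, and at the point itself the value of
  each is determined by its behaviour nearby: the limit if there is one, and \<open>0\<close> at a pole.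
\<close>

lemma nicely_meromorphic_eqI:
  assumes g: "g nicely_meromorphic_on UNIV" and h: "h nicely_meromorphic_on UNIV"
    and gF: "g has_fps_expansion F" and hF: "h has_fps_expansion F"
  shows "g = h"
proof
  fix z :: complex
  define d where "d = (\<lambda>z. g z - h z)"
  have mero: "d meromorphic_on UNIV"
    using g h unfolding d_def nicely_meromorphic_on_def by (auto intro!: meromorphic_intros)
  then have iso: "isolated_singularity_at d w" for w
    by (meson UNIV_I meromorphic_onE)
  have "d has_fps_expansion 0"
    using has_fps_expansion_diff[OF gF hF] by (simp add: d_def)
  then have "eventually (\<lambda>z. d z = 0) (at 0)"
    by (simp add: has_fps_expansion_0_iff eventually_nhds_conv_at)
  with eventually_remove_sings_eq_at[OF iso] have "eventually (\<lambda>z. remove_sings d z = 0) (at 0)"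
    by eventually_elim simp
  then have zero: "remove_sings d w = 0" for w
    by (intro frequently_eq_meromorphic_imp_constant[OF _ remove_sings_nicely_meromorphic[OF mero]])
       (auto intro: eventually_frequently)
  have ev: "eventually (\<lambda>w. g w = h w) (at z)"
    using eventually_remove_sings_eq_at[OF iso, of z]
    by eventually_elim (use zero in \<open>simp add: d_def\<close>)
  have pole: "is_pole g z \<longleftrightarrow> is_pole h z"
    by (intro is_pole_cong ev refl)
  have lim: "g \<midarrow>z\<rightarrow> c \<longleftrightarrow> h \<midarrow>z\<rightarrow> c" for c
    using filterlim_cong[OF refl refl ev] .
  have "(is_pole g z \<and> g z = 0) \<or> g \<midarrow>z\<rightarrow> g z" "(is_pole h z \<and> h z = 0) \<or> h \<midarrow>z\<rightarrow> h z"
    using g h by (auto simp: nicely_meromorphic_on_def)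
  then show "g z = h z"
    using pole lim LIM_unique not_tendsto_and_filterlim_at_infinity[of "at z" h]
    unfolding is_pole_def by (metis at_neq_bot)
qed

text \<open>
  The function \<open>g\<close> itself need not be nicely meromorphic: for \<open>qBorel_f0_formal\<close> it will be a
  quotient whose numerator and denominator may have a common zero. Its values can be trusted only
  where it is analytic.
\<close>

lemma meromorphic_continuation_eq:
  assumes "g meromorphic_on UNIV" "g has_fps_expansion F" "g analytic_on {z}"
  shows "meromorphic_continuation F z = g z"
proof -
  have "g analytic_on {0}"
    using assms(2) by (rule has_fps_expansion_imp_analytic_0)
  then have "remove_sings g has_fps_expansion F"
    using assms(2) has_fps_expansion_cong[OF eventually_remove_sings_eq_nhds] by blast
  moreover have "remove_sings g nicely_meromorphic_on UNIV"
    by (intro remove_sings_nicely_meromorphic assms)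
  ultimately have "meromorphic_continuation F = remove_sings g"
    unfolding meromorphic_continuation_def by (intro the_equality) (auto intro: nicely_meromorphic_eqI)
  with assms(3) show ?thesis by simp
qed

text \<open>
  The factor \<open>q\<^bsup>n (n - 1) / 2\<^esup>\<close> of the Borel transform cancels the divergent factor
  \<open>((- 1)\<^sup>n q\<^bsup>n (n - 1) / 2\<^esup>)\<^bsup>- 1\<^esup>\<close> of the series up to the sign \<open>(- 1)\<^sup>n\<close>, which leaves the \<open>q\<close>-binomial
  series at \<open>- \<xi> / a\<close>.
\<close>

lemma qBorel_f0_formal:
  assumes q: "norm (qpow \<tau> 1) < 1" and nz: "qpoch_inf (qpow \<tau> 1) (- \<xi> / qpow \<tau> \<alpha>) \<noteq> 0"
  shows "qBorel (qpow \<tau> 1) (f0_formal \<tau> \<alpha>) \<xi>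
       = qpoch_inf (qpow \<tau> 1) (- \<xi>) / qpoch_inf (qpow \<tau> 1) (- \<xi> / qpow \<tau> \<alpha>)"
proof -
  define q a where "q = qpow \<tau> 1" and "a = qpow \<tau> \<alpha>"
  have [simp]: "q \<noteq> 0" "a \<noteq> 0"
    by (auto simp: q_def a_def qpow_def)
  have q1: "norm q < 1" using q by (simp add: q_def)
  define F where "F = Abs_fps (\<lambda>n. qpoch q a n / qpoch q q n) oo (fps_const (- 1 / a) * fps_X)"
  define g where "g = (\<lambda>z. qpoch_inf q (a * z) / qpoch_inf q z) \<circ> (\<lambda>z. (- 1 / a) * z)"
  have "qBorel_fps q (f0_formal \<tau> \<alpha>) = F"
  proof (rule fps_ext)
    fix n
    define Q where "Q = q ^ (n * (n - 1) div 2)"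
    have "inverse ((- 1) ^ n * Q) * Q = (- 1) ^ n"
      by (cases "even n") (simp_all add: Q_def)
    moreover have "(- 1 / a) ^ n = (- 1) ^ n / a ^ n"
      by (rule power_divide)
    moreover have "qpoch q 0 n = 1"
      by (simp add: qpoch_def)
    moreover have "fps_nth (qBorel_fps q (f0_formal \<tau> \<alpha>)) n
        = (1 / a) ^ n * (qpoch q a n * qpoch q 0 n / qpoch q q n * inverse ((- 1) ^ n * Q)) * Q"
      by (simp add: qBorel_fps_def f0_formal_def Let_def basic_hypergeometric_fps_def
        power_int_minus Q_def flip: q_def a_def)
    ultimately show "fps_nth (qBorel_fps q (f0_formal \<tau> \<alpha>)) n = fps_nth F n"
      by (simp add: F_def power_one_over mult.assoc)
  qed
  moreover have "meromorphic_continuation F \<xi> = g \<xi>"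
  proof (rule meromorphic_continuation_eq)
    show "g has_fps_expansion F"
      unfolding g_def F_def
      by (intro has_fps_expansion_compose q_binomial_theorem q1 fps_expansion_intros) auto
    show "g meromorphic_on UNIV"
      unfolding g_def o_def
      by (intro meromorphic_on_divide analytic_on_imp_meromorphic_on qpoch_inf_analytic q1 analytic_intros)
    show "g analytic_on {\<xi>}"
      unfolding g_def o_def
      by (intro analytic_on_divide qpoch_inf_analytic q1 analytic_intros) (use nz in \<open>auto simp: q_def a_def\<close>)
  qed
  ultimately show ?thesis
    using \<open>a \<noteq> 0\<close> by (simp add: qBorel_def g_def flip: q_def a_def)
qed

section \<open>The Jacobi triple product\<close>

text \<open>
  Induction on \<open>M\<close>, from Pascal's rule for Gaussian binomial coefficients,
  \<open>[M + 1, k + 1] = [M, k + 1] + q\<^bsup>M - k\<^esup> [M, k]\<close>.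
\<close>

lemma q_binomial_sum:
  assumes q: "norm q < 1"
  shows "qpoch q (- x) M
       = (\<Sum>k\<le>M. qpoch q q M / (qpoch q q k * qpoch q q (M - k)) * q ^ (k * (k - 1) div 2) * x ^ k)"
proof (induction M)
  case 0
  then show ?case by (simp add: qpoch_def)
next
  case (Suc M)
  \<comment> \<open>Extending the Gaussian binomial coefficient by \<open>0\<close> to \<open>k > M\<close> lets Pascal's rule hold at \<open>k = M\<close> too.\<close>
  define c where "c = (\<lambda>M k. if k \<le> M then qpoch q q M / (qpoch q q k * qpoch q q (M - k)) else 0)"
  define t where "t = (\<lambda>k::nat. q ^ (k * (k - 1) div 2) * x ^ k)"
  have nz: "qpoch q q n \<noteq> 0" for n
    using q by (rule qpoch_q_nonzero)
  have nz': "q * q ^ n \<noteq> 1" for n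
    using power_neq_1_of_norm_less_1[OF q, of n] by simp
  have step: "qpoch q q (Suc n) = qpoch q q n * (1 - q * q ^ n)" for n
    by (simp add: qpoch_def)
  have [simp]: "qpoch q q 0 = 1" by (simp add: qpoch_def)
  have t_Suc: "t (Suc k) = q ^ k * x * t k" for k
  proof -
    have "Suc k * (Suc k - 1) div 2 = k + k * (k - 1) div 2"
      by (cases k) (simp_all add: algebra_simps)
    then show ?thesis by (simp add: t_def power_add)
  qed
  have pascal: "c (Suc M) (Suc k) = c M (Suc k) + q ^ (M - k) * c M k" if k: "k \<le> M" for k
  proof (cases "k = M")
    case True
    then show ?thesis using nz by (simp add: c_def)
  next
    case False
    define d where "d = M - Suc k"
    have M: "M = Suc (k + d)" using False k by (simp add: d_def)
    \<comment> \<open>Pascal's rule divided by the common factor \<open>(q)\<^sub>M\<close>, with \<open>A\<close>, \<open>B\<close>, \<open>E\<close> the last factors of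
      \<open>(q)\<^sub>k\<^sub>+\<^sub>1\<close>, \<open>(q)\<^sub>d\<^sub>+\<^sub>1\<close> and \<open>(q)\<^sub>M\<^sub>+\<^sub>1\<close>.\<close>
    have ratio: "E / (K * A * (L * B)) = 1 / (K * A * L) + D * (1 / (K * (L * B)))"
      if "A \<noteq> 0" "B \<noteq> 0" "K \<noteq> 0" "L \<noteq> 0" "E = B + D * A" for A B D E K L :: complex
      using that by (simp add: field_simps)
    have "c (Suc M) (Suc k) = qpoch q q M * ((1 - q * q ^ M) /
        (qpoch q q k * (1 - q * q ^ k) * (qpoch q q d * (1 - q * q ^ d))))"
      by (simp add: c_def M step del: power_Suc)
    also have "(1 - q * q ^ M) / (qpoch q q k * (1 - q * q ^ k) * (qpoch q q d * (1 - q * q ^ d)))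
        = 1 / (qpoch q q k * (1 - q * q ^ k) * qpoch q q d)
          + q ^ (M - k) * (1 / (qpoch q q k * (qpoch q q d * (1 - q * q ^ d))))"
      by (rule ratio) (use nz nz' in \<open>simp_all add: M power_add algebra_simps\<close>)
    also have "qpoch q q M * \<dots> = c M (Suc k) + q ^ (M - k) * c M k"
      by (simp add: c_def M step distrib_left)
    finally show ?thesis .
  qed
  have c0: "c n 0 = 1" for n using nz by (simp add: c_def)
  have "(\<Sum>k\<le>Suc M. c (Suc M) k * t k) = 1 * t 0 + (\<Sum>k\<le>M. c (Suc M) (Suc k) * t (Suc k))"
    by (subst sum.atMost_Suc_shift) (simp add: c0)
  also have "(\<Sum>k\<le>M. c (Suc M) (Suc k) * t (Suc k))
      = (\<Sum>k\<le>M. c M (Suc k) * t (Suc k)) + (\<Sum>k\<le>M. x * q ^ M * (c M k * t k))"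
    unfolding sum.distrib[symmetric]
  proof (rule sum.cong)
    fix k assume "k \<in> {..M}"
    then have e: "q ^ M = q ^ (M - k) * q ^ k" by (simp flip: power_add)
    have "x * q ^ M * (c M k * t k) = q ^ (M - k) * c M k * (q ^ k * x * t k)"
      by (simp add: e mult_ac)
    then show "c (Suc M) (Suc k) * t (Suc k) = c M (Suc k) * t (Suc k) + x * q ^ M * (c M k * t k)"
      using pascal[of k] \<open>k \<in> {..M}\<close> by (simp only: t_Suc distrib_right atMost_iff)
  qed simp
  also have "1 * t 0 + ((\<Sum>k\<le>M. c M (Suc k) * t (Suc k)) + (\<Sum>k\<le>M. x * q ^ M * (c M k * t k)))
     = (\<Sum>k\<le>Suc M. c M k * t k) + x * q ^ M * (\<Sum>k\<le>M. c M k * t k)"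
    by (subst sum.atMost_Suc_shift) (simp add: c0 sum_distrib_left)
  also have "(\<Sum>k\<le>Suc M. c M k * t k) = (\<Sum>k\<le>M. c M k * t k)"
    by (simp add: c_def)
  also have "\<dots> + x * q ^ M * \<dots> = (1 + x * q ^ M) * \<dots>"
    by (simp add: algebra_simps)
  also have "(\<Sum>k\<le>M. c M k * t k) = qpoch q (- x) M"
    unfolding Suc by (intro sum.cong) (simp_all add: c_def t_def mult.assoc)
  finally have "(\<Sum>k\<le>Suc M. c (Suc M) k * t k) = qpoch q (- x) (Suc M)"
    by (simp add: qpoch_def)
  moreover have "(\<Sum>k\<le>Suc M. c (Suc M) k * t k)
     = (\<Sum>k\<le>Suc M. qpoch q q (Suc M) / (qpoch q q k * qpoch q q (Suc M - k)) * q ^ (k * (k - 1) div 2) * x ^ k)"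
    by (intro sum.cong) (simp_all add: c_def t_def mult.assoc)
  ultimately show ?case by simp
qed

lemma qpoch_add: "qpoch q x (m + n) = qpoch q x m * qpoch q (x * q ^ m) n"
  by (induction n) (simp_all add: qpoch_def power_add mult_ac)

lemma of_int_triangular: "(of_int (n * (n - 1) div 2) :: 'a :: field_char_0) = of_int n * (of_int n - 1) / 2"
proof -
  have "n * (n - 1) = 2 * (n * (n - 1) div 2)" by simp
  then have "(of_int (n * (n - 1)) :: 'a) = 2 * of_int (n * (n - 1) div 2)"
    by (metis of_int_mult of_int_numeral)
  then show ?thesis by (simp add: field_simps)
qed

lemma triangular_diff:
  fixes m n :: int
  shows "(m - n) * (m - n - 1) div 2 = m * (m - 1) div 2 - n * (n - 1) div 2 - n * (m - n)"
proof -
  have "(of_int ((m - n) * (m - n - 1) div 2) :: real)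
      = of_int (m * (m - 1) div 2 - n * (n - 1) div 2 - n * (m - n))"
    unfolding of_int_diff of_int_mult of_int_triangular by (simp add: field_simps)
  then show ?thesis by (simp only: of_int_eq_iff)
qed

lemma triangular_power_int:
  fixes q :: "'a :: field"
  shows "q powi (int k * (int k - 1) div 2) = q ^ (k * (k - 1) div 2)"
proof -
  have "int k * (int k - 1) = int (k * (k - 1))"
    by (cases k) (simp_all add: algebra_simps)
  then have "int k * (int k - 1) div 2 = int (k * (k - 1)) div int 2"
    by (simp only: of_nat_numeral)
  also have "\<dots> = int (k * (k - 1) div 2)"
    by (simp only: zdiv_int)
  finally show ?thesis
    by (simp only: power_int_of_nat)
qed

text \<open>
  Apply the finite \<open>q\<close>-binomial theorem of length \<open>2 N\<close> at \<open>y = x / q\<^sup>N\<close>. The last \<open>N\<close> factors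
  \<open>1 + y q\<^sup>j\<close> form \<open>(- x)\<^sub>N\<close>; each of the first \<open>N\<close> is a monomial in \<open>x\<close> and \<open>q\<close> times a factor of
  \<open>(- q / x)\<^sub>N\<close>. The product \<open>C\<close> of these monomials cancels against the change of index
  \<open>n = k - N\<close> in the sum.
\<close>

lemma finite_Jacobi_triple_product:
  assumes q: "norm q < 1" "q \<noteq> 0" and x: "x \<noteq> 0"
  shows "qpoch q (- x) N * qpoch q (- q / x) N
       = (\<Sum>n\<in>{- int N..int N}. qpoch q q (2 * N) / (qpoch q q (nat (int N + n)) * qpoch q q (nat (int N - n)))
            * (x powi n * q powi (n * (n - 1) div 2)))"
proof -
  define y where "y = x / q ^ N"
  define C where "C = (\<Prod>j<N. x / q ^ Suc j)"
  have C0: "C \<noteq> 0" using x q by (simp add: C_def)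
  have C: "C = x ^ N / (q ^ N * q ^ (N * (N - 1) div 2))"
    unfolding C_def
  proof (induction N)
    case (Suc N)
    have "Suc N * (Suc N - 1) div 2 = N + N * (N - 1) div 2"
      by (cases N) (simp_all add: algebra_simps)
    with Suc show ?case by (simp add: power_add mult_ac)
  qed simp
  have "qpoch q (- y) N = (\<Prod>j<N. 1 + y * q ^ (N - Suc j))"
    by (simp add: qpoch_def prod.nat_diff_reindex[where g = "\<lambda>j. 1 + y * q ^ j"])
  also have "\<dots> = (\<Prod>j<N. x / q ^ Suc j * (1 - (- q / x) * q ^ j))"
  proof (rule prod.cong)
    fix j assume "j \<in> {..<N}"
    then have "q ^ N = q ^ Suc j * q ^ (N - Suc j)"
      by (simp flip: power_add power_Suc)
    then show "1 + y * q ^ (N - Suc j) = x / q ^ Suc j * (1 - (- q / x) * q ^ j)"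
      using q x by (simp add: y_def field_simps)
  qed simp
  also have "\<dots> = C * qpoch q (- q / x) N"
    by (simp only: prod.distrib C_def qpoch_def)
  finally have prod: "C * (qpoch q (- x) N * qpoch q (- q / x) N) = qpoch q (- y) (2 * N)"
    using q qpoch_add[of q "- y" N N] by (simp add: y_def mult_2)
  note prod
  also have "qpoch q (- y) (2 * N) = (\<Sum>k\<le>2 * N. qpoch q q (2 * N) / (qpoch q q k * qpoch q q (2 * N - k)) * q ^ (k * (k - 1) div 2) * y ^ k)"
    by (rule q_binomial_sum[OF q(1)])
  also have "\<dots> = (\<Sum>n\<in>{- int N..int N}. C * (qpoch q q (2 * N) / (qpoch q q (nat (int N + n)) * qpoch q q (nat (int N - n)))
            * (x powi n * q powi (n * (n - 1) div 2))))"
  proof (rule sum.reindex_bij_witness[of _ "\<lambda>n. nat (int N + n)" "\<lambda>k. int k - int N"])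
    define T where "T = q ^ (N * (N - 1) div 2)"
    have "even (N * (N - 1))"
      by (cases N) auto
    then have "N * (N - 1) = 2 * (N * (N - 1) div 2)"
      by (simp only: dvd_mult_div_cancel)
    moreover have "N * N = N + N * (N - 1)"
      by (cases N) simp_all
    ultimately have "N * N = N + N * (N - 1) div 2 + N * (N - 1) div 2"
      by simp
    then have NN: "q ^ (N * N) = q ^ N * T * T"
      by (simp only: T_def power_add)
    fix k assume k: "k \<in> {..2 * N}"
    define n where "n = int k - int N"
    have "q powi (n * (n - 1) div 2)
        = q ^ (k * (k - 1) div 2) / q ^ (N * (N - 1) div 2) / q powi (int N * (int k - int N))"
      using q by (simp add: n_def triangular_diff power_int_diff triangular_power_int del: of_nat_diff)
    also have "q powi (int N * (int k - int N)) = q ^ (N * k) / q ^ (N * N)"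
      using q by (simp add: right_diff_distrib power_int_diff flip: of_nat_mult)
    finally have "q powi (n * (n - 1) div 2)
        = q ^ (k * (k - 1) div 2) / T / (q ^ (N * k) / (q ^ N * T * T))"
      by (simp only: T_def[symmetric] NN)
    moreover have "T \<noteq> 0"
      using q by (simp add: T_def)
    moreover have "C = x ^ N / (q ^ N * T)"
      by (simp only: C T_def)
    ultimately have "C * (x powi n * q powi (n * (n - 1) div 2)) = q ^ (k * (k - 1) div 2) * y ^ k"
      using q x by (simp add: y_def power_divide flip: power_mult) (simp add: n_def power_int_diff)
    moreover have "nat (int N + n) = k" "nat (int N - n) = 2 * N - k"
      using k by (auto simp: n_def)
    ultimately show "C * (qpoch q q (2 * N) / (qpoch q q (nat (int N + (int k - int N))) *
              qpoch q q (nat (int N - (int k - int N)))) *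
              (x powi (int k - int N) * q powi ((int k - int N) * (int k - int N - 1) div 2))) =
         qpoch q q (2 * N) / (qpoch q q k * qpoch q q (2 * N - k)) * q ^ (k * (k - 1) div 2) * y ^ k"
      by (simp add: mult_ac flip: n_def)
  qed auto
  finally show ?thesis
    using C0 by (simp only: sum_distrib_left[symmetric] mult_cancel_left) simp
qed

lemma summable_theta_nat:
  fixes q x :: complex
  assumes "norm q < 1"
  shows "summable (\<lambda>n. norm (x ^ n * q ^ (n * (n - 1) div 2)))"
proof -
  define f where "f = (\<lambda>n. x ^ n * q ^ (n * (n - 1) div 2))"
  have "(\<lambda>n. norm (x * q ^ n)) \<longlonglongrightarrow> norm (x * 0)"
    by (intro tendsto_intros LIMSEQ_power_zero assms)
  then have "eventually (\<lambda>n. norm (x * q ^ n) < 1 / 2) sequentially"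
    by (rule order_tendstoD(2)) simp
  then obtain N where N: "norm (x * q ^ n) < 1 / 2" if "n \<ge> N" for n
    by (auto simp: eventually_sequentially)
  have "f (Suc n) = x * q ^ n * f n" for n
  proof -
    have "Suc n * (Suc n - 1) div 2 = n + n * (n - 1) div 2"
      by (cases n) (simp_all add: algebra_simps)
    then show ?thesis by (simp add: f_def power_add)
  qed
  then have "norm (f (Suc n)) \<le> 1 / 2 * norm (f n)" if "n \<ge> N" for n
    using mult_right_mono[OF less_imp_le[OF N[OF that]], of "norm (f n)"] by (simp add: norm_mult)
  then have "summable (\<lambda>n. norm (f n))"
    by (intro summable_ratio_test[of "1 / 2" N]) auto
  then show ?thesis by (simp add: f_def)
qed

definition theta_term :: "complex \<Rightarrow> complex \<Rightarrow> int \<Rightarrow> complex" where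
  "theta_term q x n = x powi n * q powi (n * (n - 1) div 2)"

text \<open>
  The terms with \<open>n < 0\<close> are those with positive index for the argument \<open>q / x\<close>, so both halves of
  the series reduce to the one-sided case.
\<close>

lemma theta_term_abs_summable:
  assumes q: "norm q < 1" "q \<noteq> 0" and x: "x \<noteq> 0"
  shows "(\<lambda>n. norm (theta_term q x n)) summable_on UNIV"
proof -
  have half: "(\<lambda>n. norm (theta_term q z n)) summable_on range int" for z
  proof -
    have "(\<lambda>n::nat. norm (z ^ n * q ^ (n * (n - 1) div 2))) summable_on UNIV"
      by (intro norm_summable_imp_summable_on) (use summable_theta_nat[OF q(1)] in simp)
    then show ?thesis
      by (subst summable_on_reindex) (simp_all add: theta_term_def o_def triangular_power_int)
  qed
  have "theta_term q (q / x) n = theta_term q x (- n)" for n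
  proof -
    have "(- n) * (- n - 1) = n * (n - 1) + n * 2"
      by (simp add: algebra_simps)
    then have "(- n) * (- n - 1) div 2 = n + n * (n - 1) div 2"
      by simp
    then have "q powi ((- n) * (- n - 1) div 2) = q powi n * q powi (n * (n - 1) div 2)"
      using q by (simp add: power_int_add)
    then show ?thesis
      using x by (simp add: theta_term_def power_int_divide_distrib power_int_minus field_simps)
  qed
  then have "((\<lambda>n. norm (theta_term q x n)) \<circ> uminus) summable_on range int"
    using half[of "q / x"] by (simp add: o_def)
  then have "(\<lambda>n. norm (theta_term q x n)) summable_on uminus ` range int"
    by (subst summable_on_reindex) auto
  with half[of x] have "(\<lambda>n. norm (theta_term q x n)) summable_on (range int \<union> uminus ` range int)"
    by (rule summable_on_union)
  also have "range int \<union> uminus ` range int = UNIV"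
  proof (intro equalityI subsetI)
    fix n :: int
    have "n = int (nat n) \<or> n = - int (nat (- n))" by auto
    then show "n \<in> range int \<union> uminus ` range int" by blast
  qed auto
  finally show ?thesis .
qed

text \<open>
  In the finite form, the coefficient \<open>b\<^sub>N (n) = (q)\<^sub>2\<^sub>N / ((q)\<^sub>N\<^sub>+\<^sub>n (q)\<^sub>N\<^sub>-\<^sub>n)\<close> tends to \<open>1 / (q)\<^sub>\<infinity>\<close> as
  \<open>N\<close> grows. It is bounded uniformly in \<open>N\<close> and \<open>n\<close>, because \<open>(q)\<^sub>n\<close> is never \<open>0\<close> and has a nonzero
  limit. As the theta series converges absolutely, Tannery's theorem allows the limit to be taken
  termwise; that theorem concerns series over the naturals, hence the enumeration of the
  integers by \<open>int_decode\<close>.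
\<close>

theorem Jacobi_triple_product:
  assumes q: "norm q < 1" "q \<noteq> 0" and x: "x \<noteq> 0"
  shows "(\<Sum>\<^sub>\<infinity>n. theta_term q x n) = theta_q q x"
proof -
  define P where "P = qpoch q q"
  define b where "b = (\<lambda>N n. if \<bar>n\<bar> \<le> int N
      then P (2 * N) / (P (nat (int N + n)) * P (nat (int N - n))) else 0)"
  have P: "P \<longlonglongrightarrow> qpoch_inf q q" and nz: "qpoch_inf q q \<noteq> 0" "P n \<noteq> 0" for n
    unfolding P_def
    by (rule qpoch_tendsto_qpoch_inf qpoch_inf_q_nonzero qpoch_q_nonzero, rule q)+
  have "Bseq P" "Bseq (\<lambda>n. inverse (P n))"
    using P tendsto_inverse[OF P nz(1)] by (auto intro: convergent_imp_Bseq convergentI)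
  then obtain K L where K: "K > 0" "\<And>n. norm (P n) \<le> K" and L: "L > 0" "\<And>n. norm (inverse (P n)) \<le> L"
    by (auto simp: Bseq_def)
  have bound: "norm (b N n) \<le> K * (L * L)" for N n
  proof -
    have "norm (b N n) \<le> norm (P (2 * N)) * (norm (inverse (P (nat (int N + n)))) * norm (inverse (P (nat (int N - n)))))"
      by (simp add: b_def norm_mult norm_divide norm_inverse divide_inverse)
    also have "\<dots> \<le> K * (L * L)"
      using K L by (intro mult_mono) auto
    finally show ?thesis .
  qed
  have lim: "(\<lambda>N. b N n) \<longlonglongrightarrow> 1 / qpoch_inf q q" for n
  proof -
    have "filterlim (\<lambda>N. nat (int N + m)) at_top sequentially" for m
      unfolding filterlim_at_top eventually_sequentially
    proof
      show "\<exists>M. \<forall>N\<ge>M. k \<le> nat (int N + m)" for k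
        by (intro exI[of _ "k + nat \<bar>m\<bar>"]) auto
    qed
    note this[THEN filterlim_compose[OF P]]
    note this[of n] this[of "- n"]
    moreover have "(\<lambda>N. P (2 * N)) \<longlonglongrightarrow> qpoch_inf q q"
      by (rule filterlim_compose[OF P]) (auto intro!: mult_nat_left_at_top)
    ultimately have "(\<lambda>N. P (2 * N) / (P (nat (int N + n)) * P (nat (int N + - n))))
        \<longlonglongrightarrow> qpoch_inf q q / (qpoch_inf q q * qpoch_inf q q)"
      using nz by (intro tendsto_intros) auto
    moreover have "eventually (\<lambda>N. P (2 * N) / (P (nat (int N + n)) * P (nat (int N + - n))) = b N n) sequentially"
      using eventually_ge_at_top[of "nat \<bar>n\<bar>"] by eventually_elim (auto simp: b_def)
    ultimately show ?thesis
      using nz by (simp add: tendsto_cong)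
  qed
  define S where "S = (\<Sum>\<^sub>\<infinity>n. theta_term q x n)"
  have abs: "(\<lambda>n. norm (theta_term q x n)) summable_on UNIV"
    by (rule theta_term_abs_summable[OF q x])
  have "((\<lambda>k. theta_term q x (int_decode k)) has_sum S) UNIV"
    unfolding S_def has_sum_reindex_bij_betw[OF bij_int_decode]
    using abs abs_summable_summable by (intro has_sum_infsum) blast
  then have S: "(\<lambda>k. theta_term q x (int_decode k)) sums S"
    by (rule has_sum_imp_sums)
  have "(\<lambda>k. norm (theta_term q x (int_decode k))) summable_on UNIV"
    using abs summable_on_reindex_bij_betw[OF bij_int_decode, of "\<lambda>n. norm (theta_term q x n)"] by blast
  then have M: "summable (\<lambda>k. K * (L * L) * norm (theta_term q x (int_decode k)))"
    by (intro summable_mult summable_on_imp_summable)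
  have "(\<lambda>N. \<Sum>k. b N (int_decode k) * theta_term q x (int_decode k))
      \<longlonglongrightarrow> (\<Sum>k. 1 / qpoch_inf q q * theta_term q x (int_decode k))"
  proof (rule conjunct2[OF conjunct2[OF tannerys_theorem[OF _ _ M]]])
    show "(\<lambda>N. b N (int_decode k) * theta_term q x (int_decode k))
        \<longlonglongrightarrow> 1 / qpoch_inf q q * theta_term q x (int_decode k)" for k
      by (intro tendsto_intros lim)
    show "eventually (\<lambda>(k, N). norm (b N (int_decode k) * theta_term q x (int_decode k))
        \<le> K * (L * L) * norm (theta_term q x (int_decode k))) (sequentially \<times>\<^sub>F sequentially)"
      by (intro always_eventually) (auto simp: norm_mult intro!: mult_right_mono bound)
  qed simp
  moreover have "(\<Sum>k. b N (int_decode k) * theta_term q x (int_decode k))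
      = qpoch q (- x) N * qpoch q (- q / x) N" for N
  proof -
    have "((\<lambda>n. b N n * theta_term q x n) has_sum (qpoch q (- x) N * qpoch q (- q / x) N)) UNIV"
    proof (rule has_sum_finite_neutralI)
      show "qpoch q (- x) N * qpoch q (- q / x) N = (\<Sum>n\<in>{- int N..int N}. b N n * theta_term q x n)"
        unfolding finite_Jacobi_triple_product[OF q x]
        by (intro sum.cong) (auto simp: b_def P_def theta_term_def)
    qed (auto simp: b_def)
    then have "((\<lambda>k. b N (int_decode k) * theta_term q x (int_decode k))
        has_sum (qpoch q (- x) N * qpoch q (- q / x) N)) UNIV"
      by (subst has_sum_reindex_bij_betw[OF bij_int_decode])
    then show ?thesis
      using has_sum_imp_sums sums_unique by metis
  qed
  ultimately have "(\<lambda>N. qpoch q (- x) N * qpoch q (- q / x) N) \<longlonglongrightarrow> 1 / qpoch_inf q q * S"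
    using sums_unique[OF sums_mult[OF S, of "1 / qpoch_inf q q"]] by simp
  moreover have "(\<lambda>N. qpoch q (- x) N * qpoch q (- q / x) N) \<longlonglongrightarrow> qpoch_inf q (- x) * qpoch_inf q (- q / x)"
    by (intro tendsto_intros qpoch_tendsto_qpoch_inf q)
  ultimately have "1 / qpoch_inf q q * S = qpoch_inf q (- x) * qpoch_inf q (- q / x)"
    by (rule LIMSEQ_unique)
  then show ?thesis
    using nz(1) by (simp add: theta_q_def S_def field_simps)
qed

section \<open>Quasi-periodicity and the theta function of characteristic (1, 1)\<close>

lemma theta_term_shift:
  assumes "q \<noteq> 0" "x \<noteq> 0"
  shows "theta_term q (x * q powi n) m = theta_term q x (m + n) / theta_term q x n"
proof -
  have "m * (m - 1) div 2 = (m + n) * (m + n - 1) div 2 - n * (n - 1) div 2 - n * m"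
    using triangular_diff[of "m + n" n] by simp
  then have "q powi (m * (m - 1) div 2) =
      q powi ((m + n) * (m + n - 1) div 2) / q powi (n * (n - 1) div 2) / (q powi n) powi m"
    using assms by (simp add: power_int_diff power_int_mult)
  then show ?thesis
    using assms by (simp add: theta_term_def power_int_mult_distrib power_int_add field_simps)
qed

text \<open>
  On the level of the series, replacing \<open>x\<close> by \<open>x q\<^sup>n\<close> only shifts the index by \<open>n\<close> and divides
  every term by the \<open>n\<close>-th one.
\<close>

lemma theta_q_shift:
  assumes q: "norm q < 1" "q \<noteq> 0" and x: "x \<noteq> 0"
  shows "theta_q q (x * q powi n) = theta_q q x / theta_term q x n"
proof -
  have "theta_q q (x * q powi n) = (\<Sum>\<^sub>\<infinity>m. theta_term q (x * q powi n) m)"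
    using q x by (simp add: Jacobi_triple_product)
  also have "\<dots> = (\<Sum>\<^sub>\<infinity>m. theta_term q x (m + n) / theta_term q x n)"
    by (intro infsum_cong theta_term_shift q x)
  also have "\<dots> = (\<Sum>\<^sub>\<infinity>m. theta_term q x (m + n)) / theta_term q x n"
    by (simp only: divide_inverse infsum_cmult_left')
  also have "(\<Sum>\<^sub>\<infinity>m. theta_term q x (m + n)) = (\<Sum>\<^sub>\<infinity>m. theta_term q x m)"
    by (rule infsum_reindex_bij_witness[of _ "\<lambda>m. m - n" "\<lambda>m. m + n"]) auto
  finally show ?thesis
    using q x by (simp add: Jacobi_triple_product)
qed

lemma qpow_diff: "qpow \<tau> (s - t) = qpow \<tau> s / qpow \<tau> t"
  by (simp add: qpow_def ring_distribs exp_diff)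

lemma qpow_of_int: "qpow \<tau> (of_int n) = qpow \<tau> 1 powi n"
  by (simp add: qpow_def exp_power_int mult_ac)

lemma qpow_nonzero [simp]: "qpow \<tau> s \<noteq> 0"
  by (simp add: qpow_def)

lemma norm_qpow_1: "Im \<tau> > 0 \<Longrightarrow> norm (qpow \<tau> 1) < 1"
  by (simp add: qpow_def norm_exp)

text \<open>
  Termwise, \<open>(n + 1 / 2)\<^sup>2 / 2 = n (n - 1) / 2 + n + 1 / 8\<close>, so the series for \<open>\<vartheta>\<^sub>1\<^sub>1 (v)\<close> is a
  constant times that of \<open>\<theta>\<^sub>q (- y q)\<close> with \<open>y = exp (2 \<pi> \<i> v)\<close>; one quasi-period leads back to
  \<open>\<theta>\<^sub>q (- y)\<close>.
\<close>

lemma vartheta11_eq_theta_q: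
  assumes "Im \<tau> > 0"
  shows "vartheta11 \<tau> v = - \<i> * qpow \<tau> (1 / 8) * exp (- of_real pi * \<i> * v)
           * theta_q (qpow \<tau> 1) (- exp (2 * of_real pi * \<i> * v))"
proof -
  define q where "q = qpow \<tau> 1"
  define y where "y = exp (2 * of_real pi * \<i> * v)"
  have q: "norm q < 1" "q \<noteq> 0"
    using norm_qpow_1[OF assms] by (auto simp: q_def)
  have y: "y \<noteq> 0" by (simp add: y_def)
  have "exp (2 * of_real pi * \<i> * (of_int n + 1 / 2) * (v + 1 / 2) + of_real pi * \<i> * (of_int n + 1 / 2)\<^sup>2 * \<tau>)
      = \<i> * qpow \<tau> (1 / 8) * exp (of_real pi * \<i> * v) * theta_term q (- y * q) n" for n :: int
  proof -
    let ?E = "of_real pi * \<i> + 2 * of_real pi * \<i> * v + 2 * of_real pi * \<i> * \<tau>"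
    have "2 * of_real pi * \<i> * (of_int n + 1 / 2) * (v + 1 / 2) + of_real pi * \<i> * (of_int n + 1 / 2)\<^sup>2 * \<tau>
      = of_real pi / 2 * \<i> + 2 * of_real pi * \<i> * (1 / 8) * \<tau> + of_real pi * \<i> * v
        + of_int n * ?E + 2 * of_real pi * \<i> * of_int (n * (n - 1) div 2) * \<tau>"
      unfolding of_int_triangular by (simp add: field_simps power2_eq_square)
    then have "exp (2 * of_real pi * \<i> * (of_int n + 1 / 2) * (v + 1 / 2) + of_real pi * \<i> * (of_int n + 1 / 2)\<^sup>2 * \<tau>)
      = exp (of_real pi / 2 * \<i>) * qpow \<tau> (1 / 8) * exp (of_real pi * \<i> * v)
        * exp (of_int n * ?E) * qpow \<tau> (of_int (n * (n - 1) div 2))"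
      by (simp only: exp_add qpow_def)
    also have "exp (of_int n * ?E) = (- y * q) powi n"
      by (simp add: exp_power_int[symmetric] exp_add y_def q_def qpow_def)
    also have "exp (of_real pi / 2 * \<i>) = \<i>"
      using cis_conv_exp[of "pi / 2"] by (simp add: mult_ac)
    finally show ?thesis
      by (simp only: qpow_of_int theta_term_def q_def mult_ac)
  qed
  then have "vartheta11 \<tau> v = \<i> * qpow \<tau> (1 / 8) * exp (of_real pi * \<i> * v) * (\<Sum>\<^sub>\<infinity>n. theta_term q (- y * q) n)"
    by (simp only: vartheta11_def infsum_cmult_right')
  also have "(\<Sum>\<^sub>\<infinity>n. theta_term q (- y * q) n) = theta_q q (- y * q powi 1)"
    using q y by (simp add: Jacobi_triple_product)
  also have "\<dots> = theta_q q (- y) / - y"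
    using theta_q_shift[OF q, of "- y" 1] y by (simp add: theta_term_def)
  finally have main: "vartheta11 \<tau> v = \<i> * qpow \<tau> (1 / 8) * exp (of_real pi * \<i> * v) * (theta_q q (- y) / - y)" .
  have "2 * of_real pi * \<i> * v = of_real pi * \<i> * v + of_real pi * \<i> * v"
    by (simp add: algebra_simps)
  then have "y = exp (of_real pi * \<i> * v) * exp (of_real pi * \<i> * v)"
    by (simp only: y_def exp_add)
  then have "exp (of_real pi * \<i> * v) / - y = - exp (- of_real pi * \<i> * v)"
    by (simp add: exp_minus inverse_eq_divide)
  moreover have "A * r * (t / - y) = A * (r / - y) * t" for A r t :: complex
    by simp
  ultimately have "vartheta11 \<tau> v = \<i> * qpow \<tau> (1 / 8) * - exp (- of_real pi * \<i> * v) * theta_q q (- y)"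
    using main by (simp only:)
  then show ?thesis
    by (simp add: q_def y_def)
qed

lemma exp_times_qpow_int_neq_1:
  assumes "w \<notin> period_lattice \<tau>"
  shows "exp (2 * of_real pi * \<i> * w) * qpow \<tau> 1 powi n \<noteq> 1"
proof
  assume "exp (2 * of_real pi * \<i> * w) * qpow \<tau> 1 powi n = 1"
  then have "exp (2 * of_real pi * \<i> * (w + of_int n * \<tau>)) = 1"
    by (simp add: qpow_def exp_power_int ring_distribs exp_add mult_ac)
  then have "exp (2 * of_real pi * \<i> * (w + of_int n * \<tau>)) = exp 0"
    by simp
  then obtain k :: int where
    "2 * of_real pi * \<i> * (w + of_int n * \<tau>) = 0 + of_real (of_int (2 * k) * pi) * \<i>"
    unfolding exp_eq by auto
  then have "2 * of_real pi * \<i> * (w + of_int n * \<tau>) = 2 * of_real pi * \<i> * of_int k"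
    by (simp add: mult_ac)
  then have "w + of_int n * \<tau> = of_int k"
    by (simp only: mult_cancel_left) simp
  then have "w = of_int k + of_int (- n) * \<tau>"
    by (simp add: algebra_simps)
  with assms show False
    unfolding period_lattice_def by blast
qed

section \<open>The generalized \<open>\<mu>\<close>-function as a q-Borel-Laplace sum\<close>

theorem theorem1p2:
  fixes \<tau> \<alpha> u v :: complex
  assumes "Im \<tau> > 0"
    and "u - \<alpha> * \<tau> \<notin> period_lattice \<tau>"
    and "v \<notin> period_lattice \<tau>"
  shows "f0 \<tau> \<alpha> (u - v) (- exp (2 * of_real pi * \<i> * u))
       = \<i> * qpow \<tau> (1 / 8) * gen_mu \<tau> u v \<alpha>"
proof -
  define q where "q = qpow \<tau> 1"
  define a where "a = qpow \<tau> \<alpha>"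
  define U where "U = exp (2 * of_real pi * \<i> * u)"
  define y where "y = exp (2 * of_real pi * \<i> * v)"
  define r where "r = exp (of_real pi * \<i> * v)"
  define G where "G = (\<lambda>n::int. qpoch_inf q (U * q powi n) / qpoch_inf q (U / a * q powi n))"
  have q: "norm q < 1" "q \<noteq> 0"
    using norm_qpow_1[OF assms(1)] by (auto simp: q_def)
  have nonzero: "a \<noteq> 0" "U \<noteq> 0" "y \<noteq> 0" "r \<noteq> 0"
    by (auto simp: a_def U_def y_def r_def)
  have r2: "r * r = y"
    by (simp add: r_def y_def mult_ac flip: exp_add)
  have denominator: "qpoch_inf q (U / a * q powi n) \<noteq> 0" for n
  proof (intro qpoch_inf_nonzero q)
    fix j
    have "U / a = exp (2 * of_real pi * \<i> * (u - \<alpha> * \<tau>))"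
      by (simp add: U_def a_def qpow_def right_diff_distrib exp_diff mult_ac)
    then have "U / a * q powi (n + int j) \<noteq> 1"
      using exp_times_qpow_int_neq_1[OF assms(2)] by (simp add: q_def)
    then show "U / a * q powi n * q ^ j \<noteq> 1"
      using q by (simp add: power_int_add mult.assoc)
  qed
  have Borel: "qBorel q (f0_formal \<tau> \<alpha>) (- U * q powi n) = G n" for n
    using qBorel_f0_formal[of \<tau> "- U * q powi n" \<alpha>] q denominator[of n]
    by (simp add: G_def mult_ac flip: q_def a_def)
  have X: "exp (2 * of_real pi * \<i> * (u - v)) = U / y"
    by (simp add: U_def y_def right_diff_distrib exp_diff)
  have "qLaplace q (qBorel q (f0_formal \<tau> \<alpha>)) (U / y) (- U)
      = (\<Sum>\<^sub>\<infinity>n. G n / theta_q q (- y * q powi n))"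
    using nonzero unfolding qLaplace_def by (simp add: Borel[simplified] field_simps)
  also have "\<dots> = (\<Sum>\<^sub>\<infinity>n. G n * theta_term q (- y) n * (1 / theta_q q (- y)))"
    using theta_q_shift[OF q, of "- y"] nonzero by simp
  also have "\<dots> = (\<Sum>\<^sub>\<infinity>n. G n * theta_term q (- y) n) / theta_q q (- y)"
    by (simp add: infsum_cmult_left' divide_inverse)
  also have "(\<Sum>\<^sub>\<infinity>n. G n * theta_term q (- y) n) = (\<Sum>\<^sub>\<infinity>n. G (n + 1) * theta_term q (- y) (n + 1))"
    by (rule infsum_reindex_bij_witness[of _ "\<lambda>n. n + 1" "\<lambda>n. n - 1"]) auto
  finally have Laplace: "qLaplace q (qBorel q (f0_formal \<tau> \<alpha>)) (U / y) (- U)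
      = (\<Sum>\<^sub>\<infinity>n. G (n + 1) * theta_term q (- y) (n + 1)) / theta_q q (- y)" .
  \<comment> \<open>The \<open>n\<close>-th term of the \<open>\<mu>\<close>-series contains \<open>q\<^bsup>n + 1\<^esup>\<close>, so it matches the term of index \<open>n + 1\<close>.
    The factor \<open>1 / r\<close> turns \<open>y\<^bsup>n + 1\<^esup>\<close> into \<open>exp (2 \<pi> \<i> (n + 1 / 2) v)\<close>.\<close>
  have mu_term: "(-1) powi n * exp (2 * of_real pi * \<i> * (of_int n + 1 / 2) * v)
          * qpow \<tau> (of_int n * (of_int n + 1) / 2)
          * qpoch_inf q (U * qpow \<tau> (of_int n + 1))
          / qpoch_inf q (U * qpow \<tau> (of_int n - \<alpha> + 1))
      = - (1 / r) * (G (n + 1) * theta_term q (- y) (n + 1))" for n :: int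
  proof -
    have "qpow \<tau> (of_int n * (of_int n + 1) / 2) = q powi ((n + 1) * (n + 1 - 1) div 2)"
      unfolding q_def qpow_of_int[symmetric] of_int_triangular by (simp add: mult_ac)
    moreover have "qpow \<tau> (of_int n + 1) = q powi (n + 1)"
      using qpow_of_int[of \<tau> "n + 1"] by (simp add: q_def)
    moreover have "qpow \<tau> (of_int n - \<alpha> + 1) = q powi (n + 1) / a"
      using qpow_of_int[of \<tau> "n + 1"] qpow_diff[of \<tau> "of_int (n + 1)" \<alpha>]
      by (simp add: q_def a_def algebra_simps)
    moreover have "exp (2 * of_real pi * \<i> * (of_int n + 1 / 2) * v) = y powi n * r"
      by (simp add: y_def r_def exp_power_int ring_distribs exp_add mult_ac)
    moreover have "(-1) powi n * (y powi n * r) = - (1 / r) * (- y) powi (n + 1)"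
    proof -
      have "(- y) powi n = (-1) powi n * y powi n"
        using power_int_mult_distrib[of "-1" y n] by simp
      then show ?thesis
        using nonzero by (simp add: power_int_add flip: r2)
    qed
    moreover have "U * (q powi (n + 1) / a) = U / a * q powi (n + 1)"
      by simp
    ultimately have "(-1) powi n * exp (2 * of_real pi * \<i> * (of_int n + 1 / 2) * v)
          * qpow \<tau> (of_int n * (of_int n + 1) / 2)
          * qpoch_inf q (U * qpow \<tau> (of_int n + 1))
          / qpoch_inf q (U * qpow \<tau> (of_int n - \<alpha> + 1))
      = - (1 / r) * (- y) powi (n + 1) * q powi ((n + 1) * (n + 1 - 1) div 2)
          * qpoch_inf q (U * q powi (n + 1)) / qpoch_inf q (U / a * q powi (n + 1))"
      by (simp only: mult.assoc)
    then show ?thesis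
      by (simp add: G_def theta_term_def)
  qed
  have "gen_mu \<tau> u v \<alpha> = exp (of_real pi * \<i> * \<alpha> * (u - v)) / vartheta11 \<tau> v
      * (- (1 / r) * (\<Sum>\<^sub>\<infinity>n. G (n + 1) * theta_term q (- y) (n + 1)))"
    unfolding gen_mu_def by (simp only: mu_term infsum_cmult_right' flip: q_def U_def)
  moreover have "exp (- of_real pi * \<i> * v) = 1 / r"
    by (simp add: r_def exp_minus inverse_eq_divide)
  then have "vartheta11 \<tau> v = - \<i> * qpow \<tau> (1 / 8) * (1 / r) * theta_q q (- y)"
    using vartheta11_eq_theta_q[OF assms(1), of v] by (simp only: q_def y_def)
  \<comment> \<open>At \<open>t = 0\<close> both sides are \<open>0\<close>, by division by zero.\<close>
  moreover have "\<i> * c * (e / (- \<i> * c * (1 / r) * t) * (- (1 / r) * S)) = e * (S / t)"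
    if "c \<noteq> 0" for c e t S :: complex
    using that nonzero by (cases "t = 0") (simp_all add: divide_simps)
  ultimately have "\<i> * qpow \<tau> (1 / 8) * gen_mu \<tau> u v \<alpha> = exp (of_real pi * \<i> * \<alpha> * (u - v))
      * ((\<Sum>\<^sub>\<infinity>n. G (n + 1) * theta_term q (- y) (n + 1)) / theta_q q (- y))"
    using qpow_nonzero by simp
  also have "\<dots> = f0 \<tau> \<alpha> (u - v) (- U)"
    unfolding f0_def X by (simp only: Laplace flip: q_def)
  finally show ?thesis
    by (simp only: U_def)
qed

end
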